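(* Let $f=h+\overline{g}$ be a sense-preserving harmonic mapping in $\mathbb{D}$. Then: (i) $A_f$ does not vanish identically in $\mathbb{D}$; (ii) for every $\sigma\in\mathrm{Aut}(\mathbb{D})$, $A_{f\circ\sigma}=\dfrac{\sigma'}{|\sigma'|}\,(A_f\circ\sigma)$ in $\mathbb{D}$; (iii) for every affine mapping $L(z)=az+b\overline{z}+c$ with $a,b,c\in\mathbb{C}$ and $|b/a|<1$, $A_{L\circ f}=A_f$ in $\mathbb{D}$.
   Context: $\mathbb{D}=\{z\in\mathbb{C}:|z|<1\}$ and $\mathrm{Aut}(\mathbb{D})$ is the group of holomorphic automorphisms of $\mathbb{D}$. A (complex-valued) harmonic mapping $f$ in $\mathbb{D}$ is written $f=h+\overline{g}$ with $h,g$ analytic in $\mathbb{D}$. It is called sense-preserving if its Jacobian $J_f=|h'|^2-|g'|^2$ is positive throughout $\mathbb{D}$; then $h'\neq0$ in $\mathbb{D}$, and the (second complex) dilatation $\omega=g'/h'$ is analytic with $|\omega|<1$ in $\mathbb{D}$. For such $f$ define $$P_f=\partial_z\log J_f=\frac{h''}{h'}-\frac{\overline{\omega}\,\omega'}{1-|\omega|^2},\qquad A_f(z)=\frac{1-|z|^2}{2}P_f(z)-\overline{z},\quad z\in\mathbb{D}.$$ *)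

theory Defs
  imports "HOL-Complex_Analysis.Complex_Analysis"
begin

definition wirtinger :: "(complex \<Rightarrow> complex) \<Rightarrow> complex \<Rightarrow> complex" where
  "wirtinger f z =
     (frechet_derivative f (at z) 1 - \<i> * frechet_derivative f (at z) \<i>) / 2"

definition wirtinger_bar :: "(complex \<Rightarrow> complex) \<Rightarrow> complex \<Rightarrow> complex" where
  "wirtinger_bar f z =
     (frechet_derivative f (at z) 1 + \<i> * frechet_derivative f (at z) \<i>) / 2"

definition harmonic_decomp ::
    "(complex \<Rightarrow> complex) \<Rightarrow> (complex \<Rightarrow> complex) \<Rightarrow> (complex \<Rightarrow> complex) \<Rightarrow> bool" where
  "harmonic_decomp f h g \<longleftrightarrow>
     h holomorphic_on ball 0 1 \<and> g holomorphic_on ball 0 1 \<and>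
     (\<forall>z\<in>ball 0 1. f z = h z + cnj (g z))"

(* For f = h + cnj g this is |h'|^2 - |g'|^2 (Jac_harmonic). Going through the Wirtinger
   derivatives makes it, and everything below, a function of f alone, so that it applies
   directly to compositions. *)
definition Jac :: "(complex \<Rightarrow> complex) \<Rightarrow> complex \<Rightarrow> real" where
  "Jac f z = (cmod (wirtinger f z))\<^sup>2 - (cmod (wirtinger_bar f z))\<^sup>2"

definition sense_preserving :: "(complex \<Rightarrow> complex) \<Rightarrow> bool" where
  "sense_preserving f \<longleftrightarrow> (\<forall>z\<in>ball 0 1. Jac f z > 0)"

(* For f = h + cnj g with dilatation w = g'/h' this is h''/h' - cnj w * w' / (1 - |w|^2)
   (preSchwarzian_harmonic). *)
definition preSchwarzian :: "(complex \<Rightarrow> complex) \<Rightarrow> complex \<Rightarrow> complex" where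
  "preSchwarzian f z = wirtinger (\<lambda>w. complex_of_real (ln (Jac f w))) z"

definition A_op :: "(complex \<Rightarrow> complex) \<Rightarrow> complex \<Rightarrow> complex" where
  "A_op f z = complex_of_real ((1 - (cmod z)\<^sup>2) / 2) * preSchwarzian f z - cnj z"

(* The inverse of such a map is automatically holomorphic. As the functions are total, values
   outside the disk are irrelevant. *)
definition disk_automorphism :: "(complex \<Rightarrow> complex) \<Rightarrow> bool" where
  "disk_automorphism \<sigma> \<longleftrightarrow>
     \<sigma> holomorphic_on ball 0 1 \<and> bij_betw \<sigma> (ball 0 1) (ball 0 1)"

lemma wirtinger_eqI:
  assumes "(f has_derivative D) (at z)"
  shows "wirtinger f z = (D 1 - \<i> * D \<i>) / 2"
    and "wirtinger_bar f z = (D 1 + \<i> * D \<i>) / 2"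
  using frechet_derivative_at[OF assms] by (simp_all add: wirtinger_def wirtinger_bar_def)

lemma harmonic_has_derivative:
  assumes "harmonic_decomp f h g" "z \<in> ball 0 1"
  shows "(f has_derivative (\<lambda>v. deriv h z * v + cnj (deriv g z * v))) (at z)"
proof -
  have h: "(h has_derivative (\<lambda>v. deriv h z * v)) (at z)"
    and g: "(g has_derivative (\<lambda>v. deriv g z * v)) (at z)"
    using assms holomorphic_derivI[of _ "ball 0 1" z]
    by (auto simp: harmonic_decomp_def has_field_derivative_def)
  have "((\<lambda>w. h w + cnj (g w)) has_derivative (\<lambda>v. deriv h z * v + cnj (deriv g z * v))) (at z)"
    by (intro has_derivative_add h has_derivative_cnj g)
  then show ?thesis
    by (rule has_derivative_transform_within_open[of _ _ _ _ "ball 0 1"])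
       (use assms in \<open>auto simp: harmonic_decomp_def\<close>)
qed

lemma wirtinger_harmonic:
  assumes "harmonic_decomp f h g" "z \<in> ball 0 1"
  shows "wirtinger f z = deriv h z" "wirtinger_bar f z = cnj (deriv g z)"
  by (simp_all add: wirtinger_eqI[OF harmonic_has_derivative[OF assms]] algebra_simps)

lemma Jac_harmonic:
  assumes "harmonic_decomp f h g" "z \<in> ball 0 1"
  shows "Jac f z = (cmod (deriv h z))\<^sup>2 - (cmod (deriv g z))\<^sup>2"
  by (simp add: Jac_def wirtinger_harmonic[OF assms])

lemma preSchwarzian_harmonic:
  assumes f: "harmonic_decomp f h g" and sp: "sense_preserving f" and z: "z \<in> ball 0 1"
  defines "\<omega> \<equiv> \<lambda>w. deriv g w / deriv h w"
  shows "preSchwarzian f z =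
    deriv (deriv h) z / deriv h z - cnj (\<omega> z) * deriv \<omega> z / (1 - (cmod (\<omega> z))\<^sup>2)"
proof -
  have J: "(cmod (deriv h z))\<^sup>2 - (cmod (deriv g z))\<^sup>2 > 0"
    using sp z by (simp only: sense_preserving_def Jac_harmonic[OF f z, symmetric])
  then have h0: "deriv h z \<noteq> 0" by auto
  define p q p' q' where "p = deriv h z" and "q = deriv g z"
    and "p' = deriv (deriv h) z" and "q' = deriv (deriv g) z"
  have dh: "(deriv h has_field_derivative p') (at z)"
    and dg: "(deriv g has_field_derivative q') (at z)"
    using f z holomorphic_derivI[of _ "ball 0 1" z] holomorphic_deriv[of _ "ball 0 1"]
    by (auto simp: harmonic_decomp_def p'_def q'_def)
  have Dh: "(deriv h has_derivative (\<lambda>v. p' * v)) (at z)"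
    and Dg: "(deriv g has_derivative (\<lambda>v. q' * v)) (at z)"
    using dh dg by (auto simp: has_field_derivative_def)
  define j where "j = (\<lambda>w. (deriv h w) \<bullet> (deriv h w) - (deriv g w) \<bullet> (deriv g w))"
  have jJ: "Jac f w = j w" if "w \<in> ball 0 1" for w
    using Jac_harmonic[OF f that] by (simp add: j_def power2_norm_eq_inner)
  have jz: "j z > 0" using J by (simp add: j_def power2_norm_eq_inner)
  have Dj: "(j has_derivative (\<lambda>v. 2 * (p \<bullet> (p' * v)) - 2 * (q \<bullet> (q' * v)))) (at z)"
    unfolding j_def
    by (rule has_derivative_eq_rhs, (rule derivative_intros Dh Dg)+)
       (auto simp: p_def q_def inner_commute)
  have "((\<lambda>w. complex_of_real (ln (j w))) has_derivative
      (\<lambda>v. complex_of_real ((2 * (p \<bullet> (p' * v)) - 2 * (q \<bullet> (q' * v))) * inverse (j z)))) (at z)"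
    by (intro has_derivative_of_real has_derivative_ln jz Dj)
  then have "((\<lambda>w. complex_of_real (ln (Jac f w))) has_derivative
      (\<lambda>v. complex_of_real ((2 * (p \<bullet> (p' * v)) - 2 * (q \<bullet> (q' * v))) * inverse (j z)))) (at z)"
    by (rule has_derivative_transform_within_open[of _ _ _ _ "ball 0 1"]) (use z jJ in auto)
  note W = wirtinger_eqI(1)[OF this]
  let ?A = "\<lambda>v. 2 * (p \<bullet> (p' * v)) - 2 * (q \<bullet> (q' * v))"
  have "preSchwarzian f z =
      ((complex_of_real (?A 1) - \<i> * complex_of_real (?A \<i>)) / 2) / complex_of_real (j z)"
    unfolding preSchwarzian_def W of_real_mult of_real_inverse
    by (simp only: divide_inverse algebra_simps)
  moreover have "(complex_of_real (?A 1) - \<i> * complex_of_real (?A \<i>)) / 2 =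
      cnj p * p' - cnj q * q'"
    by (simp add: complex_eq_iff inner_complex_def field_simps)
  ultimately have P: "preSchwarzian f z = (cnj p * p' - cnj q * q') / complex_of_real (j z)"
    by (simp only:)
  have jc: "complex_of_real (j z) = p * cnj p - q * cnj q"
    by (simp add: j_def p_def q_def complex_mult_cnj inner_complex_def power2_eq_square)
  have j0: "p * cnj p - q * cnj q \<noteq> 0" using jz jc by (metis less_irrefl of_real_eq_0_iff)
  have "(\<omega> has_field_derivative (q' * p - q * p') / (p * p)) (at z)"
    unfolding \<omega>_def p_def q_def by (rule DERIV_divide[OF dg dh h0])
  then have w': "deriv \<omega> z = (q' * p - q * p') / (p * p)" by (rule DERIV_imp_deriv)
  have p0: "p \<noteq> 0" "cnj p \<noteq> 0" using h0 by (auto simp: p_def)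
  have n: "complex_of_real (1 - (cmod (\<omega> z))\<^sup>2) = (p * cnj p - q * cnj q) / (p * cnj p)"
    using p0 by (simp add: \<omega>_def complex_norm_square p_def q_def diff_divide_distrib
        del: of_real_power)
  show ?thesis
    unfolding P jc w' using n p0 j0
    by (simp add: \<omega>_def p_def[symmetric] q_def[symmetric] p'_def[symmetric] divide_simps)
       (simp add: algebra_simps)
qed

end

theory Submission imports Defs
begin

text \<open>The disk carries the hyperbolic metric with density \<open>2 / (1 - \<bar>z\<bar>\<^sup>2)\<close>, and the quantity
\<open>J\<^sub>f(z) (1 - \<bar>z\<bar>\<^sup>2)\<^sup>2\<close> is, up to a constant factor, the Jacobian of \<open>f\<close> measured from the
hyperbolic disk to the Euclidean plane. The point is that \<open>A\<^sub>f\<close> is the \<open>\<partial>\<^sub>z\<close>-gradient of the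
logarithm of this quantity, in hyperbolic units (\<open>A_op_eq_gradient\<close>):
\<open>A\<^sub>f(z) = (1 - \<bar>z\<bar>\<^sup>2) / 2 \<cdot> \<partial>\<^sub>z log (J\<^sub>f(z) (1 - \<bar>z\<bar>\<^sup>2)\<^sup>2)\<close>.
The summand \<open>- cnj z\<close> in the definition of \<open>A\<^sub>f\<close> is the contribution of the weight.

The two transformation laws follow. A disk automorphism \<open>\<sigma>\<close> is a hyperbolic isometry, that is
\<open>(1 - \<bar>z\<bar>\<^sup>2) \<bar>\<sigma>'\<bar> = 1 - \<bar>\<sigma>\<bar>\<^sup>2\<close> (\<open>disk_automorphism_isometry\<close>: the Schwarz--Pick inequality
for \<open>\<sigma>\<close> and for its inverse). Hence the logarithm above is merely composed with \<open>\<sigma>\<close>, its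
\<open>\<partial>\<^sub>z\<close>-derivative picks up the factor \<open>\<sigma>'\<close>, and the isometry identity, used a second time, turns
the prefactor at \<open>z\<close> into the one at \<open>\<sigma>(z)\<close> divided by \<open>\<bar>\<sigma>'\<bar>\<close>. Composing \<open>f\<close> with \<open>L(w) = a w + b cnj w + c\<close> multiplies \<open>J\<^sub>f\<close> by
the constant \<open>\<bar>a\<bar>\<^sup>2 - \<bar>b\<bar>\<^sup>2\<close>, which \<open>\<partial>\<^sub>z log\<close> does not see.

Non-vanishing is a matter of curvature. If \<open>A\<^sub>f\<close> were identically zero, then
\<open>P\<^sub>f = 2 cnj z / (1 - \<bar>z\<bar>\<^sup>2)\<close>, whose \<open>\<partial>\<close>-bar derivative at the origin is \<open>2\<close>. But \<open>log J\<^sub>f\<close> is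
superharmonic: the \<open>\<partial>\<close>-bar derivative of \<open>P\<^sub>f = \<partial>\<^sub>z log J\<^sub>f\<close>, a quarter of the Laplacian of
\<open>log J\<^sub>f\<close>, is \<open>- (\<bar>\<omega>'\<bar> / (1 - \<bar>\<omega>\<bar>\<^sup>2))\<^sup>2 \<le> 0\<close> (\<open>wirtinger_bar_preSchwarzian\<close>).\<close>

section \<open>Calculus with Wirtinger derivatives\<close>

lemma wirtinger_cong_open:
  assumes "open S" "z \<in> S" "\<And>w. w \<in> S \<Longrightarrow> u w = v w"
  shows "wirtinger u z = wirtinger v z" and "wirtinger_bar u z = wirtinger_bar v z"
proof -
  have "(u has_derivative D) (at z) \<longleftrightarrow> (v has_derivative D) (at z)" for D
    using assms has_derivative_transform_within_open[of u D z UNIV S v]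
      has_derivative_transform_within_open[of v D z UNIV S u] by auto
  then have "frechet_derivative u (at z) = frechet_derivative v (at z)"
    unfolding frechet_derivative_def by simp
  then show "wirtinger u z = wirtinger v z" "wirtinger_bar u z = wirtinger_bar v z"
    by (simp_all add: wirtinger_def wirtinger_bar_def)
qed

lemma wirtinger_add:
  assumes "u differentiable (at z)" "v differentiable (at z)"
  shows "wirtinger (\<lambda>w. u w + v w) z = wirtinger u z + wirtinger v z"
proof -
  from assms obtain D E where D: "(u has_derivative D) (at z)" and E: "(v has_derivative E) (at z)"
    unfolding differentiable_def by blast
  show ?thesis
    unfolding wirtinger_eqI(1)[OF has_derivative_add[OF D E]] wirtinger_eqI(1)[OF D]
      wirtinger_eqI(1)[OF E]
    by (simp add: algebra_simps add_divide_distrib diff_divide_distrib)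
qed

text \<open>The general chain rule has a second term, \<open>\<partial>\<close>-bar of \<open>u\<close> times \<open>\<partial>\<^sub>z\<close> of the conjugate of \<open>s\<close>; it
drops out because \<open>s\<close> is holomorphic at \<open>z\<close>.\<close>

lemma wirtinger_compose_holomorphic:
  assumes u: "u differentiable (at (s z))" and s: "(s has_field_derivative s') (at z)"
  shows "wirtinger (u \<circ> s) z = s' * wirtinger u (s z)"
proof -
  from u obtain D where D: "(u has_derivative D) (at (s z))"
    unfolding differentiable_def by blast
  have "(s has_derivative (\<lambda>v. s' * v)) (at z)"
    using s by (simp add: has_field_derivative_def)
  from diff_chain_at[OF this D]
  have c: "(u \<circ> s has_derivative (\<lambda>v. D (s' * v))) (at z)"
    by (simp add: o_def)
  have lin: "linear D"
    using D has_derivative_linear by blast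
  \<comment> \<open>\<open>D\<close> is only real-linear, so \<open>s'\<close> cannot be pulled out of it directly.\<close>
  have Dv: "D v = of_real (Re v) * D 1 + of_real (Im v) * D \<i>" for v
  proof -
    have "v = Re v *\<^sub>R 1 + Im v *\<^sub>R \<i>"
      by (simp add: complex_eq_iff)
    then have "D v = D (Re v *\<^sub>R 1 + Im v *\<^sub>R \<i>)"
      by (rule arg_cong)
    also have "\<dots> = Re v *\<^sub>R D 1 + Im v *\<^sub>R D \<i>"
      using lin by (simp only: linear_add linear_scale)
    finally show ?thesis by (simp add: scaleR_conv_of_real)
  qed
  have s': "s' = of_real (Re s') + \<i> * of_real (Im s')"
    by (simp add: complex_eq_iff)
  have "D (s' * 1) - \<i> * D (s' * \<i>) = s' * (D 1 - \<i> * D \<i>)"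
    unfolding Dv[of "s' * 1"] Dv[of "s' * \<i>"]
    by (subst (5) s') (simp add: algebra_simps)
  then show ?thesis
    unfolding wirtinger_eqI(1)[OF c] wirtinger_eqI(1)[OF D] by simp
qed

section \<open>Automorphisms are hyperbolic isometries\<close>

lemma disk_one_minus_norm_pos: "z \<in> ball (0::complex) 1 \<Longrightarrow> 0 < 1 - (cmod z)\<^sup>2"
  by (simp add: abs_square_less_1)

lemma Moebius_function_has_field_derivative:
  assumes "1 - cnj w * z \<noteq> 0"
  shows "(Moebius_function 0 w has_field_derivative
           (1 - w * cnj w) / (1 - cnj w * z)\<^sup>2) (at z)"
proof -
  have "((\<lambda>z. (z - w) / (1 - cnj w * z)) has_field_derivative
           (1 - w * cnj w) / (1 - cnj w * z)\<^sup>2) (at z)"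
    by (rule derivative_eq_intros refl assms)+ (simp add: algebra_simps power2_eq_square)
  then show ?thesis
    by (simp add: Moebius_function_simple[abs_def])
qed

text \<open>Moving \<open>z\<close> and \<open>s z\<close> to the origin by Moebius maps reduces this to the Schwarz lemma: the
derivatives of the two Moebius maps at the points in question are \<open>1 - \<bar>z\<bar>\<^sup>2\<close> and
\<open>1 / (1 - \<bar>s z\<bar>\<^sup>2)\<close>.\<close>

lemma Schwarz_Pick:
  assumes hol: "s holomorphic_on ball 0 1" and maps: "s ` ball 0 1 \<subseteq> ball 0 1"
    and z: "z \<in> ball 0 1"
  shows "(1 - (cmod z)\<^sup>2) * cmod (deriv s z) \<le> 1 - (cmod (s z))\<^sup>2"
proof -
  have sz: "s z \<in> ball 0 1" using maps z by blast
  \<comment> \<open>\<open>Moebius_function 0 w\<close> sends \<open>w\<close> to \<open>0\<close>, and with parameter \<open>- w\<close> it sends \<open>0\<close> to \<open>w\<close>.\<close>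
  define t where "t = Moebius_function 0 (s z) \<circ> (s \<circ> Moebius_function 0 (- z))"
  have M: "Moebius_function 0 (- z) ` ball 0 1 \<subseteq> ball 0 1"
    using z by (auto intro!: Moebius_function_norm_lt_1)
  have "t holomorphic_on ball 0 1"
    unfolding t_def
  proof (rule holomorphic_on_compose_gen[where t = "ball 0 1"])
    show "s \<circ> Moebius_function 0 (- z) holomorphic_on ball 0 1"
      by (rule holomorphic_on_compose_gen[OF _ hol M])
         (use z in \<open>auto intro: Moebius_function_holomorphic\<close>)
    show "Moebius_function 0 (s z) holomorphic_on ball 0 1"
      using sz by (auto intro: Moebius_function_holomorphic)
    show "(s \<circ> Moebius_function 0 (- z)) ` ball 0 1 \<subseteq> ball 0 1"
      using M maps by (simp add: image_comp[symmetric]) blast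
  qed
  moreover have "t 0 = 0"
    by (simp add: t_def Moebius_function_of_zero Moebius_function_eq_zero)
  moreover have "cmod (t w) < 1" if "cmod w < 1" for w
  proof -
    have "s (Moebius_function 0 (- z) w) \<in> ball 0 1"
      using that M maps by (auto simp: image_subset_iff)
    then show ?thesis
      using sz by (auto simp: t_def intro: Moebius_function_norm_lt_1)
  qed
  ultimately have le1: "cmod (deriv t 0) \<le> 1"
    using Schwarz_Lemma(2)[of t 0] by simp
  let ?q = "1 - s z * cnj (s z)"
  have q: "?q = of_real (1 - (cmod (s z))\<^sup>2)" "1 - z * cnj z = of_real (1 - (cmod z)\<^sup>2)"
    by (simp_all add: complex_norm_square del: of_real_power)
  have q0: "?q \<noteq> 0"
    unfolding q using disk_one_minus_norm_pos[OF sz] by (metis less_irrefl of_real_eq_0_iff)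
  have Mz: "Moebius_function 0 (- z) 0 = z" by (simp add: Moebius_function_of_zero)
  have "(Moebius_function 0 (- z) has_field_derivative (1 - z * cnj z)) (at 0)"
    using Moebius_function_has_field_derivative[of "- z" 0] by simp
  moreover have "(s has_field_derivative deriv s z) (at (Moebius_function 0 (- z) 0))"
    unfolding Mz using hol z by (auto intro: holomorphic_derivI)
  ultimately have "(s \<circ> Moebius_function 0 (- z) has_field_derivative deriv s z * (1 - z * cnj z)) (at 0)"
    by (intro DERIV_chain)
  moreover have "(Moebius_function 0 (s z) has_field_derivative ?q / ?q\<^sup>2)
       (at ((s \<circ> Moebius_function 0 (- z)) 0))"
    using Moebius_function_has_field_derivative[of "s z" "s z"] q0 by (simp add: Mz mult.commute)
  ultimately have "(t has_field_derivative ?q / ?q\<^sup>2 * (deriv s z * (1 - z * cnj z))) (at 0)"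
    unfolding t_def by (rule DERIV_chain[rotated])
  then have "deriv t 0 = deriv s z * (1 - z * cnj z) / ?q"
    using q0 by (simp add: DERIV_imp_deriv power2_eq_square)
  then have "cmod (deriv t 0) = cmod (deriv s z * (1 - z * cnj z) / ?q)"
    by (rule arg_cong)
  then have "cmod (deriv t 0) = cmod (deriv s z) * (1 - (cmod z)\<^sup>2) / (1 - (cmod (s z))\<^sup>2)"
    unfolding q norm_divide norm_mult norm_of_real
    using disk_one_minus_norm_pos[OF sz] disk_one_minus_norm_pos[OF z]
    by (simp only: abs_of_pos)
  then show ?thesis
    using le1 disk_one_minus_norm_pos[OF sz] by (simp add: divide_le_eq mult.commute)
qed

lemma disk_automorphism_maps: "disk_automorphism s \<Longrightarrow> z \<in> ball 0 1 \<Longrightarrow> s z \<in> ball 0 1"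
  by (auto simp: disk_automorphism_def bij_betw_def)

lemma disk_automorphism_deriv:
  assumes s: "disk_automorphism s" and z: "z \<in> ball 0 1"
  shows "(s has_field_derivative deriv s z) (at z)"
  using s z by (auto simp: disk_automorphism_def intro: holomorphic_derivI)

text \<open>Equality in the Schwarz--Pick inequality: the inverse of \<open>s\<close> satisfies the inequality too, and
its derivative is the reciprocal of that of \<open>s\<close>.\<close>

lemma disk_automorphism_isometry:
  assumes s: "disk_automorphism s" and z: "z \<in> ball 0 1"
  shows "(1 - (cmod z)\<^sup>2) * cmod (deriv s z) = 1 - (cmod (s z))\<^sup>2"
proof (rule antisym)
  have hol: "s holomorphic_on ball 0 1" and inj: "inj_on s (ball 0 1)"
    and img: "s ` ball 0 1 = ball 0 1"
    using s by (auto simp: disk_automorphism_def bij_betw_def)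
  show "(1 - (cmod z)\<^sup>2) * cmod (deriv s z) \<le> 1 - (cmod (s z))\<^sup>2"
    using Schwarz_Pick[OF hol _ z] img by simp
  obtain r where r: "r holomorphic_on s ` ball 0 1"
    and d: "\<And>z. z \<in> ball 0 1 \<Longrightarrow> deriv s z * deriv r (s z) = 1"
    and rs: "\<And>z. z \<in> ball 0 1 \<Longrightarrow> r (s z) = z"
    using holomorphic_has_inverse[OF hol open_ball inj] by blast
  have "r ` ball 0 1 \<subseteq> ball 0 1"
    by (subst (1) img[symmetric]) (auto simp: rs)
  then have "(1 - (cmod (s z))\<^sup>2) * cmod (deriv r (s z)) \<le> 1 - (cmod z)\<^sup>2"
    using Schwarz_Pick[of r "s z"] r disk_automorphism_maps[OF s z] by (simp add: img rs[OF z])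
  then have "(1 - (cmod (s z))\<^sup>2) * cmod (deriv r (s z)) * cmod (deriv s z)
      \<le> (1 - (cmod z)\<^sup>2) * cmod (deriv s z)"
    by (rule mult_right_mono) simp
  moreover have "cmod (deriv r (s z)) * cmod (deriv s z) = 1"
    using d[OF z] by (metis mult.commute norm_mult norm_one)
  ultimately show "1 - (cmod (s z))\<^sup>2 \<le> (1 - (cmod z)\<^sup>2) * cmod (deriv s z)"
    by (simp add: mult.assoc)
qed

section \<open>The hyperbolic Jacobian\<close>

text \<open>Up to an additive constant, this is the logarithm of the area distortion of \<open>f\<close> from the hyperbolic
disk to the Euclidean plane. As hyperbolic area is preserved by automorphisms, it is a better
potential for \<open>A_op\<close> than \<open>ln (Jac f z)\<close>.\<close>

definition log_hyp_Jac :: "(complex \<Rightarrow> complex) \<Rightarrow> complex \<Rightarrow> real" where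
  "log_hyp_Jac f z = ln (Jac f z * (1 - (cmod z)\<^sup>2)\<^sup>2)"

lemma ln_Jac_differentiable:
  assumes f: "harmonic_decomp f h g" and sp: "sense_preserving f" and z: "z \<in> ball 0 1"
  shows "(\<lambda>w. complex_of_real (ln (Jac f w))) differentiable (at z)"
proof -
  have "deriv h holomorphic_on ball 0 1" "deriv g holomorphic_on ball 0 1"
    using f by (auto simp: harmonic_decomp_def intro: holomorphic_deriv)
  then obtain p q where
    Dh: "(deriv h has_derivative (\<lambda>v. p * v)) (at z)" and
    Dg: "(deriv g has_derivative (\<lambda>v. q * v)) (at z)"
    using holomorphic_derivI[OF _ open_ball z] by (auto simp: has_field_derivative_def)
  \<comment> \<open>Squared norms as inner products: the norm itself is not differentiable where \<open>deriv g\<close> vanishes.\<close>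
  define j where "j = (\<lambda>w. deriv h w \<bullet> deriv h w - deriv g w \<bullet> deriv g w)"
  have jJ: "j w = Jac f w" if "w \<in> ball 0 1" for w
    using Jac_harmonic[OF f that] by (simp add: j_def power2_norm_eq_inner)
  then have j: "j z > 0" using sp z by (simp add: sense_preserving_def)
  have "\<exists>D. (j has_derivative D) (at z)"
    unfolding j_def by (rule exI, (rule derivative_intros Dh Dg)+)
  then obtain D where D: "(j has_derivative D) (at z)" by blast
  have "((\<lambda>w. complex_of_real (ln (j w))) has_derivative
      (\<lambda>v. complex_of_real (D v * inverse (j z)))) (at z)"
    by (intro has_derivative_of_real has_derivative_ln j D)
  then have "((\<lambda>w. complex_of_real (ln (Jac f w))) has_derivative
      (\<lambda>v. complex_of_real (D v * inverse (j z)))) (at z)"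
    by (rule has_derivative_transform_within_open[of _ _ _ _ "ball 0 1"]) (use z jJ in auto)
  then show ?thesis unfolding differentiable_def by blast
qed

lemma log_disk_weight_derivative:
  assumes z: "z \<in> ball 0 1"
  shows "((\<lambda>w. complex_of_real (2 * ln (1 - (cmod w)\<^sup>2))) has_derivative
           (\<lambda>v. complex_of_real (- 4 * (z \<bullet> v) / (1 - (cmod z)\<^sup>2)))) (at z)"
proof -
  have p: "1 - z \<bullet> z > 0"
    using disk_one_minus_norm_pos[OF z] by (simp add: power2_norm_eq_inner)
  have "((\<lambda>w. 1 - w \<bullet> w) has_derivative (\<lambda>v. - 2 * (z \<bullet> v))) (at z)"
    by (rule has_derivative_eq_rhs, (rule derivative_intros)+) (auto simp: inner_commute)
  from has_derivative_ln[OF p this]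
  have "((\<lambda>w. 2 * ln (1 - w \<bullet> w)) has_derivative
      (\<lambda>v. 2 * (- 2 * (z \<bullet> v) * inverse (1 - z \<bullet> z)))) (at z)"
    by (intro has_derivative_mult_right)
  then have "((\<lambda>w. complex_of_real (2 * ln (1 - w \<bullet> w))) has_derivative
      (\<lambda>v. complex_of_real (2 * (- 2 * (z \<bullet> v) * inverse (1 - z \<bullet> z))))) (at z)"
    by (rule has_derivative_of_real)
  moreover have "2 * (- 2 * (z \<bullet> v) * inverse (1 - z \<bullet> z)) = - 4 * (z \<bullet> v) / (1 - (cmod z)\<^sup>2)" for v
    by (simp add: power2_norm_eq_inner field_simps)
  ultimately show ?thesis by (simp only: power2_norm_eq_inner)
qed

lemma log_hyp_Jac_split:
  assumes sp: "sense_preserving f" and z: "z \<in> ball 0 1"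
  shows "complex_of_real (log_hyp_Jac f z)
    = complex_of_real (ln (Jac f z)) + complex_of_real (2 * ln (1 - (cmod z)\<^sup>2))"
proof -
  have "Jac f z > 0" using sp z by (simp add: sense_preserving_def)
  then show ?thesis
    using disk_one_minus_norm_pos[OF z]
    by (simp add: log_hyp_Jac_def ln_mult_pos ln_realpow)
qed

lemma log_hyp_Jac_differentiable:
  assumes f: "harmonic_decomp f h g" and sp: "sense_preserving f" and z: "z \<in> ball 0 1"
  shows "(\<lambda>w. complex_of_real (log_hyp_Jac f w)) differentiable (at z)"
proof -
  have "(\<lambda>w. complex_of_real (ln (Jac f w)) + complex_of_real (2 * ln (1 - (cmod w)\<^sup>2)))
      differentiable (at z)"
    using ln_Jac_differentiable[OF f sp z] log_disk_weight_derivative[OF z]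
    by (intro differentiable_add) (auto simp: differentiable_def)
  then obtain D where "((\<lambda>w. complex_of_real (ln (Jac f w)) +
      complex_of_real (2 * ln (1 - (cmod w)\<^sup>2))) has_derivative D) (at z)"
    unfolding differentiable_def by blast
  then have "((\<lambda>w. complex_of_real (log_hyp_Jac f w)) has_derivative D) (at z)"
    by (rule has_derivative_transform_within_open[of _ _ _ _ "ball 0 1"])
       (use z log_hyp_Jac_split[OF sp] in auto)
  then show ?thesis unfolding differentiable_def by blast
qed

text \<open>The weight contributes \<open>\<partial>\<^sub>z (2 ln (1 - \<bar>z\<bar>\<^sup>2)) = - 2 cnj z / (1 - \<bar>z\<bar>\<^sup>2)\<close>, which the prefactor
turns into the \<open>- cnj z\<close> of \<open>A_op\<close>. In this form both the potential and the prefactor transform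
simply under automorphisms.\<close>

lemma A_op_eq_gradient:
  assumes f: "harmonic_decomp f h g" and sp: "sense_preserving f" and z: "z \<in> ball 0 1"
  shows "A_op f z = complex_of_real ((1 - (cmod z)\<^sup>2) / 2)
           * wirtinger (\<lambda>w. complex_of_real (log_hyp_Jac f w)) z"
proof -
  let ?r = "1 - (cmod z)\<^sup>2"
  let ?W = "\<lambda>w. complex_of_real (2 * ln (1 - (cmod w)\<^sup>2))"
  have r: "complex_of_real ?r \<noteq> 0"
    using disk_one_minus_norm_pos[OF z] by (metis less_irrefl of_real_eq_0_iff)
  have "wirtinger (\<lambda>w. complex_of_real (log_hyp_Jac f w)) z
      = wirtinger (\<lambda>w. complex_of_real (ln (Jac f w)) + ?W w) z"
    by (rule wirtinger_cong_open(1)[OF open_ball z]) (rule log_hyp_Jac_split[OF sp])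
  also have "\<dots> = preSchwarzian f z + wirtinger ?W z"
    unfolding preSchwarzian_def
    using ln_Jac_differentiable[OF f sp z] log_disk_weight_derivative[OF z]
    by (intro wirtinger_add) (auto simp: differentiable_def)
  also have "wirtinger ?W z = - 2 * cnj z / complex_of_real ?r"
  proof -
    have "wirtinger ?W z = (of_real (- 4 * (z \<bullet> 1) / ?r) - \<i> * of_real (- 4 * (z \<bullet> \<i>) / ?r)) / 2"
      by (rule wirtinger_eqI(1)[OF log_disk_weight_derivative[OF z]])
    also have "\<dots> = (of_real (- 4 * (z \<bullet> 1)) - \<i> * of_real (- 4 * (z \<bullet> \<i>))) / 2 / of_real ?r"
      by (simp only: of_real_divide diff_divide_distrib times_divide_eq_right divide_divide_eq_left
          mult.commute)
    also have "(of_real (- 4 * (z \<bullet> 1)) - \<i> * of_real (- 4 * (z \<bullet> \<i>))) / 2 = - 2 * cnj z"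
      by (simp add: complex_eq_iff inner_complex_def)
    finally show ?thesis .
  qed
  finally have "wirtinger (\<lambda>w. complex_of_real (log_hyp_Jac f w)) z
      = preSchwarzian f z - 2 * cnj z / complex_of_real ?r" by simp
  moreover have "R / 2 * P - c = R / 2 * (P - 2 * c / R)" if "R \<noteq> 0" for R P c :: complex
    using that by (simp add: field_simps)
  ultimately show ?thesis
    unfolding A_op_def using r by (simp add: of_real_divide del: of_real_diff)
qed

section \<open>Composition with automorphisms and affine mappings\<close>

lemma harmonic_decomp_compose:
  assumes f: "harmonic_decomp f h g" and s: "disk_automorphism s"
  shows "harmonic_decomp (f \<circ> s) (h \<circ> s) (g \<circ> s)"
proof -
  have "s holomorphic_on ball 0 1" "s ` ball 0 1 \<subseteq> ball 0 1"
    using s by (auto simp: disk_automorphism_def bij_betw_def)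
  then show ?thesis
    using f disk_automorphism_maps[OF s]
    by (auto simp: harmonic_decomp_def simp del: mem_ball_0
        intro!: holomorphic_on_compose_gen[where t = "ball 0 1"])
qed

lemma Jac_compose_automorphism:
  assumes f: "harmonic_decomp f h g" and s: "disk_automorphism s" and z: "z \<in> ball 0 1"
  shows "Jac (f \<circ> s) z = Jac f (s z) * (cmod (deriv s z))\<^sup>2"
proof -
  note sz = disk_automorphism_maps[OF s z]
  have "deriv (k \<circ> s) z = deriv k (s z) * deriv s z" if "k holomorphic_on ball 0 1" for k
    using disk_automorphism_deriv[OF s z] holomorphic_derivI[OF that open_ball sz]
    by (intro DERIV_imp_deriv DERIV_chain)
  then have "deriv (h \<circ> s) z = deriv h (s z) * deriv s z" "deriv (g \<circ> s) z = deriv g (s z) * deriv s z"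
    using f by (auto simp: harmonic_decomp_def)
  then show ?thesis
    by (simp add: Jac_harmonic[OF harmonic_decomp_compose[OF f s] z] Jac_harmonic[OF f sz]
        norm_mult power_mult_distrib left_diff_distrib)
qed

lemma log_hyp_Jac_compose_automorphism:
  assumes f: "harmonic_decomp f h g" and s: "disk_automorphism s" and z: "z \<in> ball 0 1"
  shows "log_hyp_Jac (f \<circ> s) z = log_hyp_Jac f (s z)"
  by (simp add: log_hyp_Jac_def Jac_compose_automorphism[OF f s z] power_mult_distrib
      mult.assoc mult.commute mult.left_commute
      flip: disk_automorphism_isometry[OF s z])

lemma disk_automorphism_deriv_nonzero:
  assumes s: "disk_automorphism s" and z: "z \<in> ball 0 1"
  shows "deriv s z \<noteq> 0"
  using disk_automorphism_isometry[OF s z]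
    disk_one_minus_norm_pos[OF disk_automorphism_maps[OF s z]] by auto

lemma sense_preserving_compose_automorphism:
  assumes f: "harmonic_decomp f h g" and sp: "sense_preserving f" and s: "disk_automorphism s"
  shows "sense_preserving (f \<circ> s)"
  using sp disk_automorphism_maps[OF s] disk_automorphism_deriv_nonzero[OF s]
  by (auto simp: sense_preserving_def Jac_compose_automorphism[OF f s] simp del: mem_ball_0)

text \<open>The potential is composed with \<open>s\<close>, so the chain rule gives the factor \<open>deriv s z\<close>. The prefactors
at \<open>z\<close> and at \<open>s z\<close> differ by the factor \<open>cmod (deriv s z)\<close> because \<open>s\<close> is an isometry.\<close>

theorem A_op_compose_automorphism:
  assumes f: "harmonic_decomp f h g" and sp: "sense_preserving f"
    and s: "disk_automorphism s" and z: "z \<in> ball 0 1"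
  shows "A_op (f \<circ> s) z = deriv s z / complex_of_real (cmod (deriv s z)) * A_op f (s z)"
proof -
  note sz = disk_automorphism_maps[OF s z]
  let ?u = "\<lambda>w. complex_of_real (log_hyp_Jac f w)"
  have "wirtinger (\<lambda>w. complex_of_real (log_hyp_Jac (f \<circ> s) w)) z = wirtinger (?u \<circ> s) z"
    by (rule wirtinger_cong_open(1)[OF open_ball z])
       (simp add: log_hyp_Jac_compose_automorphism[OF f s])
  also have "\<dots> = deriv s z * wirtinger ?u (s z)"
    by (rule wirtinger_compose_holomorphic[OF log_hyp_Jac_differentiable[OF f sp sz]
          disk_automorphism_deriv[OF s z]])
  finally have W: "wirtinger (\<lambda>w. complex_of_real (log_hyp_Jac (f \<circ> s) w)) z
      = deriv s z * wirtinger ?u (s z)" .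
  show ?thesis
    unfolding A_op_eq_gradient[OF harmonic_decomp_compose[OF f s]
        sense_preserving_compose_automorphism[OF f sp s] z] A_op_eq_gradient[OF f sp sz] W
    using disk_automorphism_deriv_nonzero[OF s z]
    by (simp add: disk_automorphism_isometry[OF s z, symmetric] del: of_real_diff)
qed

lemma harmonic_decomp_affine:
  assumes f: "harmonic_decomp f h g"
  shows "harmonic_decomp ((\<lambda>w. a * w + b * cnj w + c) \<circ> f)
           (\<lambda>z. a * h z + b * g z + c) (\<lambda>z. cnj b * h z + cnj a * g z)"
  using f by (auto simp: harmonic_decomp_def algebra_simps intro!: holomorphic_intros)

text \<open>The factor is the determinant of the real-linear map \<open>w \<mapsto> a w + b cnj w\<close>.\<close>

lemma Jac_affine:
  assumes f: "harmonic_decomp f h g" and z: "z \<in> ball 0 1"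
  shows "Jac ((\<lambda>w. a * w + b * cnj w + c) \<circ> f) z = ((cmod a)\<^sup>2 - (cmod b)\<^sup>2) * Jac f z"
proof -
  have h: "(h has_field_derivative deriv h z) (at z)" and g: "(g has_field_derivative deriv g z) (at z)"
    using f z by (auto simp: harmonic_decomp_def intro: holomorphic_derivI)
  have "deriv (\<lambda>z. a * h z + b * g z + c) z = a * deriv h z + b * deriv g z"
    and "deriv (\<lambda>z. cnj b * h z + cnj a * g z) z = cnj b * deriv h z + cnj a * deriv g z"
    by (rule DERIV_imp_deriv, (rule derivative_eq_intros h g refl)+, simp)+
  \<comment> \<open>Squared moduli become products with conjugates over the complex numbers, which leaves a
    polynomial identity.\<close>
  moreover have "(cmod (a * p + b * q))\<^sup>2 - (cmod (cnj b * p + cnj a * q))\<^sup>2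
      = ((cmod a)\<^sup>2 - (cmod b)\<^sup>2) * ((cmod p)\<^sup>2 - (cmod q)\<^sup>2)" for p q
    by (rule of_real_eq_iff[where 'a = complex, THEN iffD1])
       (simp add: complex_norm_square algebra_simps del: of_real_power)
  ultimately show ?thesis
    by (simp add: Jac_harmonic[OF harmonic_decomp_affine[OF f] z] Jac_harmonic[OF f z])
qed

theorem A_op_affine:
  assumes f: "harmonic_decomp f h g" and sp: "sense_preserving f"
    and ab: "cmod b < cmod a" and z: "z \<in> ball 0 1"
  shows "A_op ((\<lambda>w. a * w + b * cnj w + c) \<circ> f) z = A_op f z"
proof -
  let ?F = "(\<lambda>w. a * w + b * cnj w + c) \<circ> f"
  let ?k = "(cmod a)\<^sup>2 - (cmod b)\<^sup>2"
  have k: "?k > 0" using ab by (simp add: power_strict_mono)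
  have J: "Jac f w > 0" if "w \<in> ball 0 1" for w
    using sp that by (simp add: sense_preserving_def)
  have "preSchwarzian ?F z
      = wirtinger (\<lambda>w. complex_of_real (ln ?k) + complex_of_real (ln (Jac f w))) z"
    unfolding preSchwarzian_def
    by (rule wirtinger_cong_open(1)[OF open_ball z])
       (use k J in \<open>simp add: Jac_affine[OF f] ln_mult_pos\<close>)
  also have "\<dots> = wirtinger (\<lambda>w. complex_of_real (ln ?k)) z + preSchwarzian f z"
    unfolding preSchwarzian_def
    by (intro wirtinger_add ln_Jac_differentiable[OF f sp z] differentiable_const)
  also have "wirtinger (\<lambda>w. complex_of_real (ln ?k)) z = 0"
    by (simp add: wirtinger_eqI(1)[OF has_derivative_const])
  finally have P: "preSchwarzian ?F z = preSchwarzian f z" by (simp only: add_0_left)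
  show ?thesis unfolding A_op_def P ..
qed

section \<open>Non-vanishing\<close>

text \<open>The term \<open>h'' / h'\<close> of \<open>P\<^sub>f\<close> is holomorphic and does not contribute. In the other term only the
conjugate of \<open>\<omega>\<close> is differentiated, so no second derivative of \<open>\<omega>\<close> appears. The result is minus
the squared hyperbolic derivative of \<open>\<omega>\<close>; what matters is its sign.\<close>

lemma wirtinger_bar_preSchwarzian:
  assumes f: "harmonic_decomp f h g" and sp: "sense_preserving f" and z: "z \<in> ball 0 1"
  defines "\<omega> \<equiv> \<lambda>w. deriv g w / deriv h w"
  shows "wirtinger_bar (preSchwarzian f) z
    = complex_of_real (- (cmod (deriv \<omega> z) / (1 - (cmod (\<omega> z))\<^sup>2))\<^sup>2)"
proof -
  have J: "(cmod (deriv h w))\<^sup>2 - (cmod (deriv g w))\<^sup>2 > 0" if "w \<in> ball 0 1" for w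
    using sp that by (simp only: sense_preserving_def Jac_harmonic[OF f that, symmetric])
  then have h0: "deriv h w \<noteq> 0" if "w \<in> ball 0 1" for w using that by force
  have n1: "1 - (cmod (\<omega> z))\<^sup>2 > 0"
    using J[OF z] h0[OF z] by (simp add: \<omega>_def norm_divide power_divide)
  have hol: "deriv h holomorphic_on ball 0 1" "deriv g holomorphic_on ball 0 1"
    using f by (auto simp: harmonic_decomp_def intro: holomorphic_deriv)
  then have w: "\<omega> holomorphic_on ball 0 1"
    unfolding \<omega>_def using h0 by (intro holomorphic_on_divide)
  define H where "H = (\<lambda>w. deriv (deriv h) w / deriv h w)"
  have H: "H holomorphic_on ball 0 1"
    unfolding H_def using h0
    by (intro holomorphic_on_divide[OF holomorphic_deriv[OF hol(1) open_ball] hol(1)])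
  define a b c e where "a = \<omega> z" and "b = deriv \<omega> z" and "c = deriv (deriv \<omega>) z" and "e = deriv H z"
  have dH: "(H has_derivative (\<lambda>v. e * v)) (at z)"
    and dw: "(\<omega> has_derivative (\<lambda>v. b * v)) (at z)"
    and dw': "(deriv \<omega> has_derivative (\<lambda>v. c * v)) (at z)"
    using holomorphic_derivI[OF H open_ball z] holomorphic_derivI[OF w open_ball z]
      holomorphic_derivI[OF holomorphic_deriv[OF w open_ball] open_ball z]
    by (auto simp: has_field_derivative_def a_def b_def c_def e_def)
  have na: "1 - a * cnj a = of_real (1 - (cmod a)\<^sup>2)"
    by (simp add: complex_norm_square del: of_real_power)
  have n0: "1 - \<omega> z * cnj (\<omega> z) \<noteq> 0"
    using n1 na unfolding a_def by (metis less_irrefl of_real_eq_0_iff)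
  define R where "R = inverse (1 - a * cnj a)"
  have dQ: "((\<lambda>w. H w - cnj (\<omega> w) * deriv \<omega> w / (1 - \<omega> w * cnj (\<omega> w))) has_derivative
      (\<lambda>v. e * v - (- (cnj a * b) * (inverse (1 - a * cnj a) * (- (a * cnj (b * v) + b * v * cnj a))
                * inverse (1 - a * cnj a))
              + (cnj a * (c * v) + cnj (b * v) * b) / (1 - a * cnj a)))) (at z)"
    by (rule has_derivative_eq_rhs, (rule derivative_intros has_derivative_cnj dH dw dw' n0)+)
       (simp add: a_def b_def)
  have "wirtinger_bar (preSchwarzian f) z
      = wirtinger_bar (\<lambda>w. H w - cnj (\<omega> w) * deriv \<omega> w / (1 - \<omega> w * cnj (\<omega> w))) z"
    by (rule wirtinger_cong_open(2)[OF open_ball z])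
       (simp add: preSchwarzian_harmonic[OF f sp] H_def \<omega>_def complex_norm_square del: of_real_power)
  \<comment> \<open>In \<open>D 1 + \<i> * D \<i>\<close> the terms linear in \<open>v\<close> cancel and those linear in \<open>cnj v\<close> double.\<close>
  also have "\<dots> = - (b * cnj b) * (a * cnj a * R + 1) * R"
    unfolding wirtinger_eqI(2)[OF dQ] divide_inverse[of _ "1 - a * cnj a"] R_def[symmetric]
    by (simp add: field_simps)
  also have "a * cnj a * R + 1 = R"
    using n0[folded a_def] by (simp add: R_def field_simps)
  also have "- (b * cnj b) * R * R = - (b * cnj b) / (1 - a * cnj a)\<^sup>2"
    by (simp add: R_def divide_inverse power2_eq_square mult.assoc)
  also have "\<dots> = of_real (- (cmod b / (1 - (cmod a)\<^sup>2))\<^sup>2)"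
    unfolding na complex_norm_square[of b, symmetric]
    by (simp only: power_divide of_real_minus of_real_divide of_real_power minus_divide_left)
  finally show ?thesis by (simp add: a_def b_def)
qed

text \<open>If \<open>A_op f\<close> vanished on the disk, the pre-Schwarzian would be \<open>2 cnj z / (1 - \<bar>z\<bar>\<^sup>2)\<close>. Its
\<open>\<partial>\<close>-bar derivative at the origin would then be \<open>2\<close>, but it is minus a square.\<close>

theorem A_op_not_identically_zero:
  assumes f: "harmonic_decomp f h g" and sp: "sense_preserving f"
  shows "\<exists>z\<in>ball 0 1. A_op f z \<noteq> 0"
proof (rule ccontr)
  assume "\<not> ?thesis"
  then have A0: "A_op f z = 0" if "z \<in> ball 0 1" for z using that by blast
  have "preSchwarzian f z = 2 * cnj z / (1 - z * cnj z)" if "z \<in> ball 0 1" for z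
  proof -
    have n: "complex_of_real (1 - (cmod z)\<^sup>2) = 1 - z * cnj z"
      by (simp add: complex_norm_square del: of_real_power)
    have "1 - z * cnj z \<noteq> 0"
      using disk_one_minus_norm_pos[OF that] n by (metis less_irrefl of_real_eq_0_iff)
    then show ?thesis
      using A0[OF that] unfolding A_op_def of_real_divide n by (simp add: field_simps)
  qed
  then have "wirtinger_bar (preSchwarzian f) 0 = wirtinger_bar (\<lambda>z. 2 * cnj z / (1 - z * cnj z)) 0"
    by (intro wirtinger_cong_open(2)[where S = "ball 0 1"]) auto
  also have "\<dots> = 2"
  proof -
    have "((\<lambda>z. 2 * cnj z / (1 - z * cnj z)) has_derivative (\<lambda>v. 2 * cnj v)) (at 0)"
      by (rule has_derivative_eq_rhs, (rule derivative_intros has_derivative_cnj)+) auto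
    from wirtinger_eqI(2)[OF this] show ?thesis by (simp add: field_simps)
  qed
  finally have "complex_of_real (- (cmod (deriv (\<lambda>w. deriv g w / deriv h w) 0) /
      (1 - (cmod (deriv g 0 / deriv h 0))\<^sup>2))\<^sup>2) = complex_of_real 2"
    using wirtinger_bar_preSchwarzian[OF f sp, of 0] by simp
  then have "- (cmod (deriv (\<lambda>w. deriv g w / deriv h w) 0) /
      (1 - (cmod (deriv g 0 / deriv h 0))\<^sup>2))\<^sup>2 = 2"
    by (simp only: of_real_eq_iff)
  then show False by (smt (verit) zero_le_power2)
qed

theorem proposition1:
  fixes f h g :: "complex \<Rightarrow> complex"
  assumes "harmonic_decomp f h g"
    and "sense_preserving f"
  shows "(\<exists>z\<in>ball 0 1. A_op f z \<noteq> 0) \<and>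
    (\<forall>\<sigma>. disk_automorphism \<sigma> \<longrightarrow>
      (\<forall>z\<in>ball 0 1. A_op (f \<circ> \<sigma>) z =
         deriv \<sigma> z / complex_of_real (cmod (deriv \<sigma> z)) * A_op f (\<sigma> z))) \<and>
    (\<forall>a b c :: complex. a \<noteq> 0 \<and> cmod (b / a) < 1 \<longrightarrow>
      (\<forall>z\<in>ball 0 1. A_op ((\<lambda>w. a * w + b * cnj w + c) \<circ> f) z = A_op f z))"
proof -
  have "cmod b < cmod a" if "a \<noteq> 0 \<and> cmod (b / a) < 1" for a b
    using that by (auto simp: norm_divide divide_less_eq)
  then show ?thesis
    using A_op_not_identically_zero[OF assms] A_op_compose_automorphism[OF assms]
      A_op_affine[OF assms] by blast
qed

end
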